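(* Let $\gamma>1$, $k_1,k_2,k_3>-1$ and $k=\frac{(1+k_1)(1+k_3)}{(1+k_2)^2}-1$. Let $U_-$ be a state with $\rho_->0$, $p_->0$, $u_->0$ and Mach number $M_-$. Let $\mathcal{D}(U_-,k_1,k_2,k_3)$ be the set of all states $U_+$ that can be connected to $U_-$ (as left-hand state) by a stationary wave with coefficients $k_1,k_2,k_3$ satisfying the Monotonicity Criterion. Set $$I=\frac{\sqrt{(\gamma M_-^2+1)^2-(\gamma+1)M_-^2[(\gamma-1)M_-^2+2](1+k)}}{\gamma M_-^2+1}.$$ Then $\mathcal{D}(U_-,k_1,k_2,k_3)$ consists exactly of the states $U_+$ whose Mach number $M_+$ is given by (each line applying when its condition on $M_-$ holds; if two lines of a case apply, both values are allowed; if none applies, the set is empty): if $k>0$: $M_+=\sqrt{\frac{1-I}{1+\gamma I}}$ for $0<M_-\le M_1^*$, and $M_+=\sqrt{\frac{1+I}{1-\gamma I}}$ for $M_2^*\le M_-<+\infty$; if $k<0$: $M_+=\sqrt{\frac{1-I}{1+\gamma I}}$ for $0<M_-\le 1$, and $M_+=\sqrt{\frac{1+I}{1-\gamma I}}$ for $1\le M_-<M_3^{**}$; if $k=0$: $M_+=\sqrt{\frac{1-I}{1+\gamma I}}$ for $0<M_-\le 1$, and $M_+=\sqrt{\frac{1+I}{1-\gamma I}}$ for $1<M_-<+\infty$; and whose density, velocity and pressure are $$\rho_+=\rho_-\Big(\frac{M_-}{M_+}\Big)^2\frac{\gamma M_+^2+1}{\gamma M_-^2+1}\frac{(1+k_1)^2}{1+k_2},\quad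 u_+=u_-\Big(\frac{M_+}{M_-}\Big)^2\frac{\gamma M_-^2+1}{\gamma M_+^2+1}\frac{1+k_2}{1+k_1},\quad p_+=p_-\frac{\gamma M_-^2+1}{\gamma M_+^2+1}(1+k_2).$$
   Context: States are $U=(\rho,\rho u,E)$ with $\rho>0$, $p>0$, $E=\frac{p}{\gamma-1}+\frac12\rho u^2$; sound speed $a=\sqrt{\gamma p/\rho}$; Mach number $M=u/a$; $\lambda_1=u-a$, $\lambda_2=u$, $\lambda_3=u+a$. Subscripts refer to the corresponding state. A stationary wave with coefficients $k_1,k_2,k_3$, left-hand state $U_-$ ($u_->0$) and right-hand state $U_+$ is a pair satisfying the jump relation $\rho_-u_-(1+k_1)=\rho_+u_+$, $(\rho_-u_-^2+p_-)(1+k_2)=\rho_+u_+^2+p_+$, $(E_-+p_-)u_-(1+k_3)=(E_++p_+)u_+$. Monotonicity Criterion: $\lambda_j(U_-)\lambda_j(U_+)\ge 0$ for $j=1,2,3$. Critical Mach numbers. For $k>0$: $M_1^*=\sqrt{\frac{k\gamma+k+1-(\gamma+1)\sqrt{k(k+1)}}{k+1-k\gamma^2}}$ if $k\ne\frac{1}{\gamma^2-1}$, and $M_1^*=\sqrt{\frac{\gamma-1}{2\gamma}}$ if $k=\frac1{\gamma^2-1}$; $M_2^*=\sqrt{\frac{k\gamma+k+1+(\gamma+1)\sqrt{k(k+1)}}{k+1-k\gamma^2}}$ if $0<k<\frac1{\gamma^2-1}$, and $M_2^*=+\infty$ if $k\ge\frac1{\gamma^2-1}$. For $-1<k<0$: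 $M_3^{**}=\sqrt{\frac{\gamma\sqrt{1+k}+\sqrt{1+k\gamma^2}}{\gamma\sqrt{1+k}-\gamma\sqrt{1+k\gamma^2}}}$ if $-\frac1{\gamma^2}<k<0$, and $M_3^{**}=1$ if $-1<k\le-\frac1{\gamma^2}$. *)

theory Defs
  imports Complex_Main "HOL-Library.Extended_Real"
begin

text \<open>States are given in the conserved variables \<open>(\<rho>, \<rho> u, E)\<close>. The pressure is
  obtained by solving \<open>E = p / (\<gamma> - 1) + \<rho> u\<^sup>2 / 2\<close> for \<open>p\<close>.\<close>

record euler_state =
  dens :: real
  mom :: real
  energy :: real

definition velocity :: "euler_state \<Rightarrow> real" where
  "velocity U = mom U / dens U"

definition pressure :: "real \<Rightarrow> euler_state \<Rightarrow> real" where
  "pressure \<gamma> U = (\<gamma> - 1) * (energy U - 1 / 2 * dens U * (velocity U)\<^sup>2)"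

definition admissible :: "real \<Rightarrow> euler_state \<Rightarrow> bool" where
  "admissible \<gamma> U \<longleftrightarrow> dens U > 0 \<and> pressure \<gamma> U > 0"

definition sound_speed :: "real \<Rightarrow> euler_state \<Rightarrow> real" where
  "sound_speed \<gamma> U = sqrt (\<gamma> * pressure \<gamma> U / dens U)"

definition mach :: "real \<Rightarrow> euler_state \<Rightarrow> real" where
  "mach \<gamma> U = velocity U / sound_speed \<gamma> U"

definition lambda1 :: "real \<Rightarrow> euler_state \<Rightarrow> real" where
  "lambda1 \<gamma> U = velocity U - sound_speed \<gamma> U"

definition lambda2 :: "real \<Rightarrow> euler_state \<Rightarrow> real" where
  "lambda2 \<gamma> U = velocity U"

definition lambda3 :: "real \<Rightarrow> euler_state \<Rightarrow> real" where
  "lambda3 \<gamma> U = velocity U + sound_speed \<gamma> U"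

definition stationary_wave ::
    "real \<Rightarrow> real \<Rightarrow> real \<Rightarrow> real \<Rightarrow> euler_state \<Rightarrow> euler_state \<Rightarrow> bool" where
  "stationary_wave \<gamma> k1 k2 k3 Um Up \<longleftrightarrow>
     admissible \<gamma> Um \<and> velocity Um > 0 \<and> admissible \<gamma> Up \<and>
     dens Um * velocity Um * (1 + k1) = dens Up * velocity Up \<and>
     (dens Um * (velocity Um)\<^sup>2 + pressure \<gamma> Um) * (1 + k2)
       = dens Up * (velocity Up)\<^sup>2 + pressure \<gamma> Up \<and>
     (energy Um + pressure \<gamma> Um) * velocity Um * (1 + k3)
       = (energy Up + pressure \<gamma> Up) * velocity Up"

definition monotonicity_criterion :: "real \<Rightarrow> euler_state \<Rightarrow> euler_state \<Rightarrow> bool" where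
  "monotonicity_criterion \<gamma> Um Up \<longleftrightarrow>
     lambda1 \<gamma> Um * lambda1 \<gamma> Up \<ge> 0 \<and>
     lambda2 \<gamma> Um * lambda2 \<gamma> Up \<ge> 0 \<and>
     lambda3 \<gamma> Um * lambda3 \<gamma> Up \<ge> 0"

definition wave_set :: "real \<Rightarrow> euler_state \<Rightarrow> real \<Rightarrow> real \<Rightarrow> real \<Rightarrow> euler_state set" where
  "wave_set \<gamma> Um k1 k2 k3 =
     {Up. stationary_wave \<gamma> k1 k2 k3 Um Up \<and> monotonicity_criterion \<gamma> Um Up}"

text \<open>The critical Mach numbers \<open>M\<^sub>1\<^sup>*\<close> and \<open>M\<^sub>2\<^sup>*\<close> are meaningful for \<open>k > 0\<close>,
  \<open>M\<^sub>3\<^sup>*\<^sup>*\<close> for \<open>-1 < k < 0\<close>.\<close>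

definition M1_crit :: "real \<Rightarrow> real \<Rightarrow> real" where
  "M1_crit \<gamma> k =
     (if k \<noteq> 1 / (\<gamma>\<^sup>2 - 1)
      then sqrt ((k * \<gamma> + k + 1 - (\<gamma> + 1) * sqrt (k * (k + 1))) / (k + 1 - k * \<gamma>\<^sup>2))
      else sqrt ((\<gamma> - 1) / (2 * \<gamma>)))"

definition M2_crit :: "real \<Rightarrow> real \<Rightarrow> ereal" where
  "M2_crit \<gamma> k =
     (if k < 1 / (\<gamma>\<^sup>2 - 1)
      then ereal (sqrt ((k * \<gamma> + k + 1 + (\<gamma> + 1) * sqrt (k * (k + 1))) / (k + 1 - k * \<gamma>\<^sup>2)))
      else \<infinity>)"

definition M3_crit :: "real \<Rightarrow> real \<Rightarrow> real" where
  "M3_crit \<gamma> k =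
     (if - (1 / \<gamma>\<^sup>2) < k
      then sqrt ((\<gamma> * sqrt (1 + k) + sqrt (1 + k * \<gamma>\<^sup>2))
                 / (\<gamma> * sqrt (1 + k) - \<gamma> * sqrt (1 + k * \<gamma>\<^sup>2)))
      else 1)"

end

theory Submission
  imports Defs
begin

text \<open>Put \<open>m = M\<^sub>-\<^sup>2\<close>, \<open>x = M\<^sub>+\<^sup>2\<close> and \<open>y(x) = (x - 1) / (\<gamma> x + 1)\<close>. Mass and momentum balance determine
  \<open>\<rho>\<^sub>+\<close>, \<open>u\<^sub>+\<close>, \<open>p\<^sub>+\<close> from \<open>x\<close>. Since (mass flux) \<open>\<times>\<close> (energy flux) / (momentum flux)\<open>\<^sup>2\<close> depends only on the
  Mach number, the remaining equation relates \<open>x\<close> to \<open>m\<close>; up to a constant factor that quotient is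
  \<open>1 - y\<^sup>2\<close>, so the equation reads \<open>y(x)\<^sup>2 = 1 - (1 + k) (1 - y(m)\<^sup>2)\<close>, that is \<open>y(x) = \<plusminus>I\<close>.
  The Monotonicity Criterion forces \<open>y(x)\<close> and \<open>y(m)\<close> not to have opposite signs, and positivity of \<open>x\<close>
  means \<open>-1 < y(x) < 1 / \<gamma>\<close>. The critical Mach numbers mark where \<open>I\<^sup>2 \<ge> 0\<close> and \<open>I < 1 / \<gamma>\<close> fail.\<close>

section \<open>The squared value of \<open>I\<close> as a function of \<open>m\<close>\<close>

text \<open>\<open>I\<^sup>2\<close>, kept without its root: \<open>sqrt\<close> is also defined on
  negative reals, so the condition that \<open>I\<close> be a genuine root has to be tracked as a
  sign condition on this quotient.\<close>

definition mach_disc :: "real \<Rightarrow> real \<Rightarrow> real \<Rightarrow> real" where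
  "mach_disc \<gamma> k m =
     ((\<gamma> * m + 1)\<^sup>2 - (\<gamma> + 1) * m * ((\<gamma> - 1) * m + 2) * (1 + k)) / (\<gamma> * m + 1)\<^sup>2"

text \<open>Difference of squares: \<open>\<gamma> * m + 1\<close> plus and minus
  \<open>m - 1\<close> give the factors \<open>(\<gamma> + 1) * m\<close> and
  \<open>(\<gamma> - 1) * m + 2\<close>.\<close>

lemma mach_disc_eq:
  assumes "\<gamma> > 1" "m > 0"
  shows "mach_disc \<gamma> k m = 1 - (1 + k) * (1 - ((m - 1) / (\<gamma> * m + 1))\<^sup>2)"
proof -
  have "\<gamma> * m + 1 > 0" using assms by (simp add: add_pos_pos)
  then have "1 - ((m - 1) / (\<gamma> * m + 1))\<^sup>2 = ((\<gamma> * m + 1)\<^sup>2 - (m - 1)\<^sup>2) / (\<gamma> * m + 1)\<^sup>2"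
    unfolding power_divide by (simp add: diff_divide_distrib[of _ _ "(\<gamma> * m + 1)\<^sup>2"])
  also have "(\<gamma> * m + 1)\<^sup>2 - (m - 1)\<^sup>2 = (\<gamma> + 1) * m * ((\<gamma> - 1) * m + 2)"
    by (simp add: power2_eq_square algebra_simps)
  finally show ?thesis
    using \<open>\<gamma> * m + 1 > 0\<close> by (simp add: mach_disc_def diff_divide_distrib)
qed

text \<open>Keeps \<open>-I\<close> above -1, the value of y at x = 0, so that the subsonic branch
  yields a positive x.\<close>

lemma mach_disc_less_1:
  assumes "\<gamma> > 1" "m > 0" "k > -1"
  shows "mach_disc \<gamma> k m < 1"
proof -
  have "\<gamma> * m + 1 > 0" using assms by (simp add: add_pos_pos)
  moreover have "(\<gamma> + 1) * m * ((\<gamma> - 1) * m + 2) * (1 + k) > 0"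
    using assms by (intro mult_pos_pos) (auto simp: add_pos_pos)
  ultimately show ?thesis by (simp add: mach_disc_def)
qed

text \<open>Only the numerator carries the sign. It is a polynomial in \<open>m\<close> of degree at
  most two; for k > 0 the finite critical numbers are the square roots of its positive
  roots.\<close>

lemma mach_disc_nonneg_iff:
  assumes "\<gamma> > 1" "m > 0"
  shows "mach_disc \<gamma> k m \<ge> 0 \<longleftrightarrow>
    (k + 1 - k * \<gamma>\<^sup>2) * m\<^sup>2 - 2 * (k * \<gamma> + k + 1) * m + 1 \<ge> 0"
proof -
  have "\<gamma> * m + 1 > 0" using assms by (simp add: add_pos_pos)
  moreover have "(\<gamma> * m + 1)\<^sup>2 - (\<gamma> + 1) * m * ((\<gamma> - 1) * m + 2) * (1 + k)
     = (k + 1 - k * \<gamma>\<^sup>2) * m\<^sup>2 - 2 * (k * \<gamma> + k + 1) * m + 1"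
    by (simp add: power2_eq_square algebra_simps)
  ultimately show ?thesis by (simp add: mach_disc_def zero_le_divide_iff)
qed

section \<open>The Moebius map y and its subsonic and supersonic branches\<close>

lemma mach_fraction_less:
  fixes \<gamma> x :: real
  assumes "\<gamma> > 1" "x > 0"
  shows "\<gamma> * ((x - 1) / (\<gamma> * x + 1)) < 1"
proof -
  have "\<gamma> * x + 1 > 0" using assms by (simp add: add_pos_pos)
  then show ?thesis using assms by (simp add: field_simps)
qed

lemma mobius_inverse:
  fixes \<gamma> x y :: real
  assumes "\<gamma> > 1" "x > 0" "y = (x - 1) / (\<gamma> * x + 1)"
  shows "x = (1 + y) / (1 - \<gamma> * y)"
proof -
  have pos: "\<gamma> * x + 1 > 0" using assms by (simp add: add_pos_pos)
  have 1: "1 - \<gamma> * y > 0" using mach_fraction_less[OF assms(1,2)] assms(3) by simp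
  have "y * (\<gamma> * x + 1) = x - 1" using pos assms(3) by simp
  then have "x * (1 - \<gamma> * y) = 1 + y" by (simp add: algebra_simps)
  then show ?thesis using 1 by (simp add: field_simps)
qed

text \<open>With \<open>mobius_inverse\<close>, this makes y a bijection from x > 0 onto -1 < y <
  1/\<gamma>; the excluded ends are the values at 0 and at infinity.\<close>

lemma mobius_of_inverse:
  fixes \<gamma> x y :: real
  assumes "\<gamma> > 1" "-1 < y" "\<gamma> * y < 1" "x = (1 + y) / (1 - \<gamma> * y)"
  shows "x > 0" "(x - 1) / (\<gamma> * x + 1) = y"
proof -
  have 1: "1 - \<gamma> * y > 0" using assms by simp
  show x: "x > 0" using assms by simp
  have "x * (1 - \<gamma> * y) = 1 + y" using 1 assms(4) by simp
  then have "x - 1 = y * (\<gamma> * x + 1)" by (simp add: algebra_simps)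
  moreover have "\<gamma> * x + 1 > 0" using assms x by (simp add: add_pos_pos)
  ultimately show "(x - 1) / (\<gamma> * x + 1) = y" by simp
qed

text \<open>P \<le> 1 means y \<le> 0, so the square determines y as \<open>- sqrt d\<close>, and
  inverting y gives P. The requirement y > -1 is met because d < 1.\<close>

lemma subsonic_branch_iff:
  fixes \<gamma> d P :: real
  assumes "\<gamma> > 1" "d < 1"
  shows "P > 0 \<and> P \<le> 1 \<and> ((P\<^sup>2 - 1) / (\<gamma> * P\<^sup>2 + 1))\<^sup>2 = d \<longleftrightarrow>
    d \<ge> 0 \<and> P = sqrt ((1 - sqrt d) / (1 + \<gamma> * sqrt d))" (is "?L \<longleftrightarrow> ?R")
proof
  assume L: ?L
  define y where "y = (P\<^sup>2 - 1) / (\<gamma> * P\<^sup>2 + 1)"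
  have pos: "\<gamma> * P\<^sup>2 + 1 > 0" using assms L by (simp add: add_pos_pos)
  have "P\<^sup>2 \<le> 1" using L by (simp add: power_le_one)
  then have "y \<le> 0" using pos by (simp add: y_def divide_nonpos_pos)
  then have sd: "sqrt d = - y" using L y_def by (metis real_sqrt_abs abs_of_nonpos)
  have "P\<^sup>2 = (1 + y) / (1 - \<gamma> * y)"
    using mobius_inverse[OF assms(1) _ y_def] L by simp
  then have "P = sqrt ((1 + y) / (1 - \<gamma> * y))" using L by (metis real_sqrt_abs abs_of_pos)
  then show ?R using L sd by auto
next
  assume R: ?R
  define y where "y = - sqrt d"
  define x where "x = (1 + y) / (1 - \<gamma> * y)"
  have y: "-1 < y" "y \<le> 0" using R assms by (auto simp: y_def)
  then have gy: "\<gamma> * y \<le> 0" using assms by (simp add: mult_nonneg_nonpos)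
  note m = mobius_of_inverse[OF assms(1) y(1) _ x_def]
  have x0: "x > 0" using m gy by simp
  have P: "P = sqrt x" using R by (simp add: x_def y_def)
  have "1 + y \<le> 1 - \<gamma> * y" using gy y by linarith
  then have "x \<le> 1" using gy by (simp add: x_def)
  moreover have "((x - 1) / (\<gamma> * x + 1))\<^sup>2 = d" using m gy R by (simp add: y_def)
  ultimately show ?L using P x0 by simp
qed

text \<open>Here y \<ge> 0, so y is \<open>sqrt d\<close>. The upper end y < 1/\<gamma> of the range
  now becomes a genuine restriction on d.\<close>

lemma supersonic_branch_iff:
  fixes \<gamma> d P :: real
  assumes "\<gamma> > 1"
  shows "P \<ge> 1 \<and> ((P\<^sup>2 - 1) / (\<gamma> * P\<^sup>2 + 1))\<^sup>2 = d \<longleftrightarrow>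
    d \<ge> 0 \<and> d < 1 / \<gamma>\<^sup>2 \<and> P = sqrt ((1 + sqrt d) / (1 - \<gamma> * sqrt d))" (is "?L \<longleftrightarrow> ?R")
proof
  assume L: ?L
  define y where "y = (P\<^sup>2 - 1) / (\<gamma> * P\<^sup>2 + 1)"
  have P2: "P\<^sup>2 \<ge> 1" using L by simp
  then have P2pos: "P\<^sup>2 > 0" by linarith
  have pos: "\<gamma> * P\<^sup>2 + 1 > 0" using assms P2pos by (intro add_pos_pos mult_pos_pos) auto
  then have y0: "y \<ge> 0" using P2 by (simp add: y_def)
  then have sd: "sqrt d = y" using L y_def by (metis real_sqrt_abs abs_of_nonneg)
  have "\<gamma> * y < 1" using mach_fraction_less[OF assms P2pos] by (simp add: y_def)
  then have "y < 1 / \<gamma>" using assms by (simp add: field_simps)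
  then have "y\<^sup>2 < (1 / \<gamma>)\<^sup>2" using y0 by (intro power_strict_mono) auto
  then have d: "d < 1 / \<gamma>\<^sup>2" using L y_def by (simp add: power_one_over)
  have "P\<^sup>2 = (1 + y) / (1 - \<gamma> * y)"
    by (rule mobius_inverse[OF assms P2pos y_def])
  then have "P = sqrt ((1 + y) / (1 - \<gamma> * y))"
    using L by (metis real_sqrt_abs abs_of_nonneg order_trans zero_le_one)
  moreover have "d \<ge> 0" using L by (metis zero_le_power2)
  ultimately show ?R using sd d by auto
next
  assume R: ?R
  define y where "y = sqrt d"
  define x where "x = (1 + y) / (1 - \<gamma> * y)"
  have y0: "y \<ge> 0" using R by (simp add: y_def)
  have "y < sqrt (1 / \<gamma>\<^sup>2)" using R by (simp add: y_def)
  then have "y < 1 / \<gamma>" using assms by (simp add: real_sqrt_divide)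
  then have gy: "\<gamma> * y < 1" using assms by (simp add: field_simps)
  note m = mobius_of_inverse[OF assms _ gy x_def]
  have gy0: "\<gamma> * y \<ge> 0" using y0 assms by simp
  have x1: "x \<ge> 1" using gy gy0 y0 by (simp add: x_def)
  have P: "P = sqrt x" using R by (simp add: x_def y_def)
  have "((x - 1) / (\<gamma> * x + 1))\<^sup>2 = d" using m(2) y0 R by (simp add: y_def order_less_le_trans[of "-1" 0])
  then show ?L using P x1 by simp
qed

section \<open>The critical Mach numbers\<close>

text \<open>Factoring through the reciprocal roots \<open>b + s\<close> and \<open>b - s\<close>
  avoids dividing by the leading coefficient, which may vanish. Since 1 separates these reciprocals,
  the sign of one factor is known on each side of m = 1.\<close>

lemma mach_quadratic_roots:
  fixes \<gamma> k :: real
  assumes "\<gamma> > 1" "k > 0"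
  defines "b \<equiv> k * \<gamma> + k + 1" and "s \<equiv> (\<gamma> + 1) * sqrt (k * (k + 1))"
  shows "(b + s) * (b - s) = k + 1 - k * \<gamma>\<^sup>2"
    and "(k + 1 - k * \<gamma>\<^sup>2) * m\<^sup>2 - 2 * b * m + 1 = (1 - (b + s) * m) * (1 - (b - s) * m)"
    and "b - s < 1" and "b + s > 1" and "s > 0"
proof -
  have s2: "s\<^sup>2 = (\<gamma> + 1)\<^sup>2 * (k * (k + 1))"
    using assms(2) by (simp add: s_def power_mult_distrib)
  show eq: "(b + s) * (b - s) = k + 1 - k * \<gamma>\<^sup>2"
  proof -
    have "(b + s) * (b - s) = b\<^sup>2 - s\<^sup>2" by (simp add: power2_eq_square algebra_simps)
    also have "\<dots> = k + 1 - k * \<gamma>\<^sup>2"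
      unfolding s2 by (simp add: b_def power2_eq_square algebra_simps)
    finally show ?thesis .
  qed
  show "(k + 1 - k * \<gamma>\<^sup>2) * m\<^sup>2 - 2 * b * m + 1 = (1 - (b + s) * m) * (1 - (b - s) * m)"
    unfolding eq[symmetric] by (simp add: power2_eq_square algebra_simps)
  \<comment> \<open>Since \<open>b - 1 = (\<gamma> + 1) * k\<close>, the claim
    \<open>b - s < 1\<close> amounts to k lying below \<open>sqrt (k * (k + 1))\<close>.\<close>
  have "sqrt (k * k) < sqrt (k * (k + 1))" using assms by (intro real_sqrt_less_mono) simp
  then have "k < sqrt (k * (k + 1))" using assms by simp
  then have "(\<gamma> + 1) * k < s" using assms by (simp add: s_def)
  then show "b - s < 1" by (simp add: b_def algebra_simps)
  show "s > 0" using assms by (simp add: s_def)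
  moreover have "k * \<gamma> > 0" using assms by simp
  ultimately show "b + s > 1" using assms(2) unfolding b_def by linarith
qed

text \<open>\<open>M1_crit\<close> squared is the root \<open>1 / (b + s)\<close>, which is below 1.
  For m < 1 the factor with \<open>b - s\<close> is positive, so the other factor decides the
  sign.\<close>

lemma le_M1_crit_iff:
  assumes "\<gamma> > 1" "k > 0" "M > 0"
  shows "M \<le> M1_crit \<gamma> k \<longleftrightarrow> M < 1 \<and> mach_disc \<gamma> k (M\<^sup>2) \<ge> 0"
proof -
  define a where "a = k + 1 - k * \<gamma>\<^sup>2"
  define b where "b = k * \<gamma> + k + 1"
  define s where "s = (\<gamma> + 1) * sqrt (k * (k + 1))"
  note q = mach_quadratic_roots[OF assms(1,2), folded b_def s_def, folded a_def]
  have g: "\<gamma>\<^sup>2 > 1" using assms by simp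
  have a0: "a = 0 \<longleftrightarrow> k = 1 / (\<gamma>\<^sup>2 - 1)" using g by (auto simp: a_def field_simps)
  \<comment> \<open>Both clauses of the definition are this one value. If \<open>a = 0\<close>, then
    \<open>b = s\<close> and the generic quotient degenerates to 0/0; the special clause supplies
    \<open>1 / (2 * b)\<close> with \<open>b = \<gamma> / (\<gamma> - 1)\<close>.\<close>
  have M1: "M1_crit \<gamma> k = sqrt (1 / (b + s))"
  proof (cases "a = 0")
    case True
    then have "b = s" using q(1,4) by auto
    have k: "k = 1 / (\<gamma>\<^sup>2 - 1)" using True a0 by simp
    have f: "\<gamma>\<^sup>2 - 1 = (\<gamma> - 1) * (\<gamma> + 1)" by (simp add: power2_eq_square algebra_simps)
    have "b = k * (\<gamma> + 1) + 1" by (simp add: b_def algebra_simps)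
    also have "\<dots> = 1 / (\<gamma> - 1) + 1" unfolding k f using assms by simp
    also have "\<dots> = \<gamma> / (\<gamma> - 1)" using assms by (simp add: field_simps)
    finally have "b = \<gamma> / (\<gamma> - 1)" .
    then have "1 / (b + b) = (\<gamma> - 1) / (2 * \<gamma>)" by simp
    then show ?thesis using k \<open>b = s\<close> by (simp add: M1_crit_def)
  next
    case False
    have "(b - s) / a = 1 / (b + s)" using q(1,4) False by (simp add: field_simps)
    then show ?thesis using False a0 by (simp add: M1_crit_def a_def b_def s_def)
  qed
  have M2: "M\<^sup>2 > 0" using assms by simp
  have "M \<le> M1_crit \<gamma> k \<longleftrightarrow> M\<^sup>2 \<le> 1 / (b + s)"
    unfolding M1 using assms q(4) by (metis abs_of_pos real_sqrt_abs real_sqrt_le_iff)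
  also have "\<dots> \<longleftrightarrow> (b + s) * M\<^sup>2 \<le> 1" using q(4) by (simp add: field_simps)
  also have "\<dots> \<longleftrightarrow> M\<^sup>2 < 1 \<and> (1 - (b + s) * M\<^sup>2) * (1 - (b - s) * M\<^sup>2) \<ge> 0"
  proof
    assume h: "(b + s) * M\<^sup>2 \<le> 1"
    have "1 * M\<^sup>2 < (b + s) * M\<^sup>2" using M2 q(4) by (intro mult_strict_right_mono) auto
    moreover have "(b - s) * M\<^sup>2 \<le> (b + s) * M\<^sup>2" using q(5) M2 by (intro mult_right_mono) auto
    ultimately show "M\<^sup>2 < 1 \<and> (1 - (b + s) * M\<^sup>2) * (1 - (b - s) * M\<^sup>2) \<ge> 0" using h by auto
  next
    assume h: "M\<^sup>2 < 1 \<and> (1 - (b + s) * M\<^sup>2) * (1 - (b - s) * M\<^sup>2) \<ge> 0"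
    have "(b - s) * M\<^sup>2 < 1 * M\<^sup>2" using M2 q(3) by (intro mult_strict_right_mono) auto
    then have "1 - (b - s) * M\<^sup>2 > 0" using h by linarith
    then have "1 - (b + s) * M\<^sup>2 \<ge> 0" using h by (simp add: zero_le_mult_iff)
    then show "(b + s) * M\<^sup>2 \<le> 1" by simp
  qed
  also have "M\<^sup>2 < 1 \<longleftrightarrow> M < 1" using assms by (simp add: power2_less_1_iff)
  also have "(1 - (b + s) * M\<^sup>2) * (1 - (b - s) * M\<^sup>2) \<ge> 0 \<longleftrightarrow> mach_disc \<gamma> k (M\<^sup>2) \<ge> 0"
    using mach_disc_nonneg_iff[OF assms(1) M2] q(2)[of "M\<^sup>2"] by (simp add: a_def b_def)
  finally show ?thesis .
qed

text \<open>For m > 1 the factor with \<open>b + s\<close> is negative, so the one with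
  \<open>b - s\<close> must be nonpositive. This is possible only if \<open>b - s > 0\<close>,
  equivalently \<open>a > 0\<close>, and then holds from the root \<open>1 / (b - s)\<close> on;
  otherwise no m > 1 qualifies, hence the value \<infinity>.\<close>

lemma M2_crit_le_iff:
  assumes "\<gamma> > 1" "k > 0" "M > 0"
  shows "M2_crit \<gamma> k \<le> ereal M \<longleftrightarrow> M > 1 \<and> mach_disc \<gamma> k (M\<^sup>2) \<ge> 0"
proof -
  define a where "a = k + 1 - k * \<gamma>\<^sup>2"
  define b where "b = k * \<gamma> + k + 1"
  define s where "s = (\<gamma> + 1) * sqrt (k * (k + 1))"
  note q = mach_quadratic_roots[OF assms(1,2), folded b_def s_def, folded a_def]
  have g: "\<gamma>\<^sup>2 > 1" using assms by simp
  have a0: "k < 1 / (\<gamma>\<^sup>2 - 1) \<longleftrightarrow> a > 0" using g by (auto simp: a_def field_simps)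
  have abs_iff: "a > 0 \<longleftrightarrow> b - s > 0"
    using q(1,4) by (metis zero_less_mult_pos mult_pos_pos less_trans zero_less_one)
  have M2: "M\<^sup>2 > 0" using assms by simp
  have "M2_crit \<gamma> k \<le> ereal M \<longleftrightarrow> a > 0 \<and> sqrt ((b + s) / a) \<le> M"
    using a0 by (auto simp: M2_crit_def a_def b_def s_def)
  also have "\<dots> \<longleftrightarrow> b - s > 0 \<and> (b + s) / a \<le> M\<^sup>2"
    unfolding abs_iff using assms by (metis abs_of_pos real_sqrt_abs real_sqrt_le_iff)
  also have "\<dots> \<longleftrightarrow> b - s > 0 \<and> (b - s) * M\<^sup>2 \<ge> 1"
  proof -
    have "(b + s) / a = 1 / (b - s)" if "b - s > 0"
      using that q(4) unfolding q(1)[symmetric] by simp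
    moreover have "1 / (b - s) \<le> M\<^sup>2 \<longleftrightarrow> (b - s) * M\<^sup>2 \<ge> 1" if "b - s > 0"
      using that by (simp add: pos_divide_le_eq mult.commute)
    ultimately show ?thesis by auto
  qed
  also have "\<dots> \<longleftrightarrow> M\<^sup>2 > 1 \<and> (1 - (b + s) * M\<^sup>2) * (1 - (b - s) * M\<^sup>2) \<ge> 0"
  proof
    assume h: "b - s > 0 \<and> (b - s) * M\<^sup>2 \<ge> 1"
    have "(b - s) * M\<^sup>2 < 1 * M\<^sup>2" using M2 q(3) by (intro mult_strict_right_mono) auto
    moreover have "(b - s) * M\<^sup>2 \<le> (b + s) * M\<^sup>2" using q(5) M2 by (intro mult_right_mono) auto
    ultimately show "M\<^sup>2 > 1 \<and> (1 - (b + s) * M\<^sup>2) * (1 - (b - s) * M\<^sup>2) \<ge> 0"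
      using h by (auto intro!: mult_nonpos_nonpos)
  next
    assume h: "M\<^sup>2 > 1 \<and> (1 - (b + s) * M\<^sup>2) * (1 - (b - s) * M\<^sup>2) \<ge> 0"
    have "1 * M\<^sup>2 < (b + s) * M\<^sup>2" using M2 q(4) by (intro mult_strict_right_mono) auto
    then have "1 - (b + s) * M\<^sup>2 < 0" using h by linarith
    then have *: "(b - s) * M\<^sup>2 \<ge> 1" using h by (simp add: zero_le_mult_iff)
    then have "(b - s) * M\<^sup>2 > 0" by linarith
    then show "b - s > 0 \<and> (b - s) * M\<^sup>2 \<ge> 1" using * M2 by (simp add: zero_less_mult_iff)
  qed
  also have "M\<^sup>2 > 1 \<longleftrightarrow> M > 1" using assms by (smt (verit) power2_less_1_iff one_less_power pos2 power_le_one)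
  also have "(1 - (b + s) * M\<^sup>2) * (1 - (b - s) * M\<^sup>2) \<ge> 0 \<longleftrightarrow> mach_disc \<gamma> k (M\<^sup>2) \<ge> 0"
    using mach_disc_nonneg_iff[OF assms(1) M2] q(2)[of "M\<^sup>2"] by (simp add: a_def b_def)
  finally show ?thesis .
qed

lemma mach_fraction_square_less:
  fixes \<gamma> m :: real
  assumes "\<gamma> > 1" "m \<ge> 1"
  shows "((m - 1) / (\<gamma> * m + 1))\<^sup>2 < 1 / \<gamma>\<^sup>2"
proof -
  have "\<gamma> * m + 1 > 0" using assms by (simp add: add_pos_pos)
  then have "0 \<le> (m - 1) / (\<gamma> * m + 1)" using assms by simp
  moreover have "(m - 1) / (\<gamma> * m + 1) < 1 / \<gamma>"
    using mach_fraction_less[of \<gamma> m] assms by (simp add: field_simps)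
  ultimately have "((m - 1) / (\<gamma> * m + 1))\<^sup>2 < (1 / \<gamma>)\<^sup>2" by (intro power_strict_mono) auto
  then show ?thesis by (simp add: power_one_over)
qed

text \<open>The quotient is \<open>z - k * (1 - z)\<close>, hence at most z for k \<ge> 0, and z is
  already below the bound. So an upper critical number arises only for k < 0.\<close>

lemma mach_disc_less_inverse_square:
  assumes "\<gamma> > 1" "k \<ge> 0" "m \<ge> 1"
  shows "mach_disc \<gamma> k m < 1 / \<gamma>\<^sup>2"
proof -
  define z where "z = ((m - 1) / (\<gamma> * m + 1))\<^sup>2"
  have z: "z < 1 / \<gamma>\<^sup>2" using mach_fraction_square_less assms z_def by simp
  also have "1 / \<gamma>\<^sup>2 < 1" using assms by simp
  finally have "k * (1 - z) \<ge> 0" using assms by simp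
  then show ?thesis using z mach_disc_eq[of \<gamma> m k, folded z_def] assms by (simp add: algebra_simps)
qed

text \<open>The bound on \<open>mach_disc\<close> rearranges to y(\<open>M\<^sup>2\<close>) < w for
  a threshold w, and \<open>M3_crit\<close> squared is the point where y equals w. M \<ge> 1 makes y
  nonnegative, so that squares can be compared.\<close>

lemma less_M3_crit_iff:
  assumes "\<gamma> > 1" "-1 < k" "k < 0" "M \<ge> 1"
  shows "M < M3_crit \<gamma> k \<longleftrightarrow> mach_disc \<gamma> k (M\<^sup>2) < 1 / \<gamma>\<^sup>2"
proof -
  define z where "z = (M\<^sup>2 - 1) / (\<gamma> * M\<^sup>2 + 1)"
  \<comment> \<open>The value of y at which \<open>mach_disc\<close> reaches
    \<open>1 / \<gamma>\<^sup>2\<close>; a true root only when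
    \<open>1 + k * \<gamma>\<^sup>2\<close> is positive.\<close>
  define w where "w = sqrt (1 + k * \<gamma>\<^sup>2) / (\<gamma> * sqrt (1 + k))"
  have M2: "M\<^sup>2 \<ge> 1" using assms by simp
  then have M2p: "M\<^sup>2 > 0" by linarith
  have pos: "\<gamma> * M\<^sup>2 + 1 > 0" using assms M2p by (simp add: add_pos_pos)
  have z0: "z \<ge> 0" using M2 pos by (simp add: z_def)
  have "mach_disc \<gamma> k (M\<^sup>2) < 1 / \<gamma>\<^sup>2 \<longleftrightarrow> (1 + k) * z\<^sup>2 < (1 + k * \<gamma>\<^sup>2) / \<gamma>\<^sup>2"
  proof -
    have "mach_disc \<gamma> k (M\<^sup>2) = (1 + k) * z\<^sup>2 - k"
      using mach_disc_eq[OF assms(1) M2p, folded z_def, of k] by (simp add: algebra_simps)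
    moreover have "(1 + k * \<gamma>\<^sup>2) / \<gamma>\<^sup>2 = 1 / \<gamma>\<^sup>2 + k" using assms by (simp add: field_simps)
    ultimately show ?thesis by linarith
  qed
  also have "\<dots> \<longleftrightarrow> z\<^sup>2 < (1 + k * \<gamma>\<^sup>2) / (\<gamma>\<^sup>2 * (1 + k))"
  proof -
    have "(1 + k * \<gamma>\<^sup>2) / (\<gamma>\<^sup>2 * (1 + k)) = (1 + k * \<gamma>\<^sup>2) / \<gamma>\<^sup>2 / (1 + k)" by simp
    then show ?thesis
      using assms by (simp only: pos_less_divide_eq mult.commute)
  qed
  finally have D: "mach_disc \<gamma> k (M\<^sup>2) < 1 / \<gamma>\<^sup>2 \<longleftrightarrow> z\<^sup>2 < (1 + k * \<gamma>\<^sup>2) / (\<gamma>\<^sup>2 * (1 + k))" .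
  show ?thesis
  proof (cases "- (1 / \<gamma>\<^sup>2) < k")
    \<comment> \<open>A square cannot lie below a nonpositive bound, and the default
      \<open>M3_crit = 1\<close> likewise excludes every M \<ge> 1.\<close>
    case False
    then have "1 + k * \<gamma>\<^sup>2 \<le> 0" using assms by (simp add: field_simps)
    then have "(1 + k * \<gamma>\<^sup>2) / (\<gamma>\<^sup>2 * (1 + k)) \<le> 0" using assms by (simp add: divide_nonpos_pos)
    then have "\<not> z\<^sup>2 < (1 + k * \<gamma>\<^sup>2) / (\<gamma>\<^sup>2 * (1 + k))"
      using zero_le_power2[of z] by linarith
    then show ?thesis using D False assms by (simp add: M3_crit_def)
  next
    case True
    then have p: "1 + k * \<gamma>\<^sup>2 > 0" using assms by (simp add: field_simps)
    have sk: "sqrt (1 + k) > 0" using assms by simp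
    have w0: "w > 0" using p sk assms by (simp add: w_def)
    have w2: "w\<^sup>2 = (1 + k * \<gamma>\<^sup>2) / (\<gamma>\<^sup>2 * (1 + k))"
      using p assms by (simp add: w_def power_divide power_mult_distrib)
    \<comment> \<open>k < 0 and \<open>\<gamma>\<^sup>2 > 1\<close> place w below 1/\<gamma>, inside
      the range of y, so y can be inverted at w.\<close>
    have "1 + k * \<gamma>\<^sup>2 < 1 + k" using assms one_less_power[of \<gamma> 2] by simp
    then have "sqrt (1 + k * \<gamma>\<^sup>2) < sqrt (1 + k)" by simp
    then have gw: "\<gamma> * w < 1" using assms sk by (simp add: w_def)
    have s: "sqrt (1 + k * \<gamma>\<^sup>2) = w * (\<gamma> * sqrt (1 + k))"
      using sk assms by (simp add: w_def)
    \<comment> \<open>Writing the second root through w exposes the common factor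
      \<open>\<gamma> * sqrt (1 + k)\<close>; what remains is the inverse of y at w.\<close>
    have "(\<gamma> * sqrt (1 + k) + sqrt (1 + k * \<gamma>\<^sup>2)) / (\<gamma> * sqrt (1 + k) - \<gamma> * sqrt (1 + k * \<gamma>\<^sup>2))
        = ((1 + w) * (\<gamma> * sqrt (1 + k))) / ((1 - \<gamma> * w) * (\<gamma> * sqrt (1 + k)))"
      unfolding s by (simp add: algebra_simps)
    also have "\<dots> = (1 + w) / (1 - \<gamma> * w)" using sk assms by simp
    finally have "M3_crit \<gamma> k = sqrt ((1 + w) / (1 - \<gamma> * w))" using True by (simp add: M3_crit_def)
    then have "M < M3_crit \<gamma> k \<longleftrightarrow> M\<^sup>2 < (1 + w) / (1 - \<gamma> * w)"
      using assms by (metis abs_of_nonneg order_trans zero_le_one real_sqrt_abs real_sqrt_less_iff)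
    also have "\<dots> \<longleftrightarrow> M\<^sup>2 - 1 < w * (\<gamma> * M\<^sup>2 + 1)"
      using gw by (simp add: pos_less_divide_eq) (auto simp: algebra_simps)
    also have "\<dots> \<longleftrightarrow> z < w" using pos by (simp add: z_def pos_divide_less_eq)
    also have "\<dots> \<longleftrightarrow> z\<^sup>2 < w\<^sup>2"
      using z0 w0 by (auto intro: power_strict_mono power2_less_imp_less)
    finally show ?thesis using D w2 by simp
  qed
qed

section \<open>Case distinction on the sign of k\<close>

text \<open>The two branches give the conditions d \<ge> 0 and
  \<open>d < 1 / \<gamma>\<^sup>2\<close>; the sign of k decides which is automatic. For k > 0 only
  the first restricts, for k < 0 only the second, for k = 0 neither.\<close>

lemma mach_relation_cases:
  assumes "\<gamma> > 1" "k > -1" "M > 0"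
  defines "J \<equiv> sqrt (mach_disc \<gamma> k (M\<^sup>2))"
  shows "P > 0 \<and> ((P\<^sup>2 - 1) / (\<gamma> * P\<^sup>2 + 1))\<^sup>2 = mach_disc \<gamma> k (M\<^sup>2) \<and> (M - 1) * (P - 1) \<ge> 0 \<longleftrightarrow>
    k > 0 \<and> (0 < M \<and> M \<le> M1_crit \<gamma> k \<and> P = sqrt ((1 - J) / (1 + \<gamma> * J))
              \<or> M2_crit \<gamma> k \<le> ereal M \<and> P = sqrt ((1 + J) / (1 - \<gamma> * J)))
    \<or> k < 0 \<and> (0 < M \<and> M \<le> 1 \<and> P = sqrt ((1 - J) / (1 + \<gamma> * J))
              \<or> 1 \<le> M \<and> M < M3_crit \<gamma> k \<and> P = sqrt ((1 + J) / (1 - \<gamma> * J)))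
    \<or> k = 0 \<and> (0 < M \<and> M \<le> 1 \<and> P = sqrt ((1 - J) / (1 + \<gamma> * J))
              \<or> 1 < M \<and> P = sqrt ((1 + J) / (1 - \<gamma> * J)))"
    (is "?L \<longleftrightarrow> ?R")
proof -
  define d where "d = mach_disc \<gamma> k (M\<^sup>2)"
  define Q where "Q \<longleftrightarrow> ((P\<^sup>2 - 1) / (\<gamma> * P\<^sup>2 + 1))\<^sup>2 = d"
  define A where "A \<longleftrightarrow> P = sqrt ((1 - J) / (1 + \<gamma> * J))"
  define B where "B \<longleftrightarrow> P = sqrt ((1 + J) / (1 - \<gamma> * J))"
  have M2: "M\<^sup>2 > 0" using assms by simp
  have d1: "d < 1" using mach_disc_less_1[OF assms(1) M2 assms(2)] by (simp add: d_def)
  have sub: "P > 0 \<and> P \<le> 1 \<and> Q \<longleftrightarrow> d \<ge> 0 \<and> A"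
    using subsonic_branch_iff[OF assms(1) d1] by (simp add: Q_def A_def J_def d_def)
  have sup: "P \<ge> 1 \<and> Q \<longleftrightarrow> d \<ge> 0 \<and> d < 1 / \<gamma>\<^sup>2 \<and> B"
    using supersonic_branch_iff[OF assms(1)] by (simp add: Q_def B_def J_def d_def)
  \<comment> \<open>At \<open>M = 1\<close> the sign condition leaves P free; any positive P then
    falls under one of the first two disjuncts.\<close>
  have L: "?L \<longleftrightarrow> (M \<le> 1 \<and> P > 0 \<and> P \<le> 1 \<and> Q) \<or> (M \<ge> 1 \<and> P \<ge> 1 \<and> Q)
      \<or> (M = 1 \<and> P > 0 \<and> Q)"
    unfolding Q_def d_def by (auto simp: zero_le_mult_iff)
  also have "\<dots> \<longleftrightarrow> (M \<le> 1 \<and> d \<ge> 0 \<and> A) \<or> (M \<ge> 1 \<and> d \<ge> 0 \<and> d < 1 / \<gamma>\<^sup>2 \<and> B)"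
    using sub sup by (smt (verit))
  finally have main: "?L \<longleftrightarrow> (M \<le> 1 \<and> d \<ge> 0 \<and> A) \<or> (M \<ge> 1 \<and> d \<ge> 0 \<and> d < 1 / \<gamma>\<^sup>2 \<and> B)" .
  define z where "z = ((M\<^sup>2 - 1) / (\<gamma> * M\<^sup>2 + 1))\<^sup>2"
  have dz: "d = 1 - (1 + k) * (1 - z)"
    using mach_disc_eq[OF assms(1) M2] by (simp add: d_def z_def)
  have z0: "z \<ge> 0" by (simp add: z_def)
  \<comment> \<open>At k = 0 \<open>mach_disc\<close> is z itself.\<close>
  have z1: "z < 1"
    using mach_disc_less_1[OF assms(1) M2, of 0] mach_disc_eq[OF assms(1) M2, of 0]
    by (simp add: z_def)
  have small: "d < 1 / \<gamma>\<^sup>2" if "k \<ge> 0" "M \<ge> 1"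
    using mach_disc_less_inverse_square[OF assms(1) that(1), of "M\<^sup>2"] that by (simp add: d_def)
  \<comment> \<open>For k > 0 this makes d negative, so the sonic point belongs to neither
    branch.\<close>
  have at1: "M = 1 \<Longrightarrow> d = -k" using dz by (simp add: z_def)
  consider "k > 0" | "k < 0" | "k = 0" by linarith
  then show ?thesis
  proof cases
    case 1
    have "?R \<longleftrightarrow> (M < 1 \<and> d \<ge> 0 \<and> A) \<or> (M > 1 \<and> d \<ge> 0 \<and> B)"
      using 1 le_M1_crit_iff[OF assms(1) 1 assms(3)] M2_crit_le_iff[OF assms(1) 1 assms(3)] assms(3)
      by (simp add: A_def B_def d_def)
    then show ?thesis unfolding main using at1 small 1 by (smt (verit))
  next
    case 2
    have "k * (1 - z) \<le> 0" using 2 z1 by (simp add: mult_nonpos_nonneg)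
    then have d0: "d \<ge> 0" using dz z0 by (simp add: algebra_simps)
    have "?R \<longleftrightarrow> (M \<le> 1 \<and> A) \<or> (M \<ge> 1 \<and> d < 1 / \<gamma>\<^sup>2 \<and> B)"
      using 2 less_M3_crit_iff[OF assms(1,2) 2] assms(3) by (auto simp: A_def B_def d_def)
    then show ?thesis unfolding main using d0 by simp
  next
    case 3
    have d0: "d \<ge> 0" using dz z0 3 by simp
    \<comment> \<open>Here J = 0 and both formulas give P = 1, so the supersonic line may start
      strictly above 1 without losing a state.\<close>
    have "A \<longleftrightarrow> B" if "M = 1"
      using at1[OF that] 3 by (simp add: A_def B_def J_def d_def)
    moreover have "?R \<longleftrightarrow> (M \<le> 1 \<and> A) \<or> (M > 1 \<and> B)"
      using 3 assms(3) by (auto simp: A_def B_def)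
    ultimately show ?thesis unfolding main using d0 small 3 by (smt (verit))
  qed
qed

section \<open>The jump relation in terms of squared Mach numbers\<close>

text \<open>Both sides have the shape \<open>1 - (\<gamma> + 1) * s\<close>, so comparing them
  compares the quotients s. The cross-multiplied form is the one the energy balance
  produces.\<close>

lemma mach_relation_iff:
  assumes "\<gamma> > 1" "m > 0" "x > 0"
  shows "((x - 1) / (\<gamma> * x + 1))\<^sup>2 = mach_disc \<gamma> k m \<longleftrightarrow>
    x * (2 + (\<gamma> - 1) * x) * (\<gamma> * m + 1)\<^sup>2 = (1 + k) * (m * (2 + (\<gamma> - 1) * m)) * (\<gamma> * x + 1)\<^sup>2"
proof -
  have p: "\<gamma> * x + 1 > 0" "\<gamma> * m + 1 > 0" using assms by (auto simp: add_pos_pos)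
  have x: "(x - 1)\<^sup>2 = (\<gamma> * x + 1)\<^sup>2 - (\<gamma> + 1) * (x * (2 + (\<gamma> - 1) * x))"
    by (simp add: power2_eq_square algebra_simps)
  have "((x - 1) / (\<gamma> * x + 1))\<^sup>2 = 1 - (\<gamma> + 1) * (x * (2 + (\<gamma> - 1) * x) / (\<gamma> * x + 1)\<^sup>2)"
    unfolding power_divide x using p by (simp add: diff_divide_distrib)
  moreover have "mach_disc \<gamma> k m = 1 - (\<gamma> + 1) * ((1 + k) * (m * (2 + (\<gamma> - 1) * m)) / (\<gamma> * m + 1)\<^sup>2)"
    unfolding mach_disc_def using p by (simp add: diff_divide_distrib ac_simps)
  moreover have affine: "1 - (\<gamma> + 1) * s = 1 - (\<gamma> + 1) * t \<longleftrightarrow> s = t" for s t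
    using assms by simp
  ultimately have "((x - 1) / (\<gamma> * x + 1))\<^sup>2 = mach_disc \<gamma> k m \<longleftrightarrow>
     x * (2 + (\<gamma> - 1) * x) / (\<gamma> * x + 1)\<^sup>2 = (1 + k) * (m * (2 + (\<gamma> - 1) * m)) / (\<gamma> * m + 1)\<^sup>2"
    using affine[of "x * (2 + (\<gamma> - 1) * x) / (\<gamma> * x + 1)\<^sup>2"] by (simp only:)
  then show ?thesis using p by (simp add: frac_eq_eq)
qed

text \<open>Successive elimination: momentum gives \<open>p'\<close>, mass then gives
  \<open>u'\<close> and \<open>r'\<close>, and energy leaves the relation between x and m.\<close>

lemma jump_relation_iff:
  fixes \<gamma> :: real
  assumes g: "\<gamma> > 1" and k: "k1 > -1" "k2 > -1" "k3 > -1"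
    and pos: "r > 0" "u > 0" "p > 0" "m > 0" "r' > 0" "u' > 0" "p' > 0" "x > 0"
    and m: "r * u\<^sup>2 = \<gamma> * p * m" and x: "r' * u'\<^sup>2 = \<gamma> * p' * x"
  shows "r * u * (1 + k1) = r' * u' \<and>
     (r * u\<^sup>2 + p) * (1 + k2) = r' * u'\<^sup>2 + p' \<and>
     p * (2 + (\<gamma> - 1) * m) * u * (1 + k3) = p' * (2 + (\<gamma> - 1) * x) * u' \<longleftrightarrow>
     x * (2 + (\<gamma> - 1) * x) * (\<gamma> * m + 1)\<^sup>2
       = (1 + k1) * (1 + k3) / (1 + k2)\<^sup>2 * (m * (2 + (\<gamma> - 1) * m)) * (\<gamma> * x + 1)\<^sup>2 \<and>
     r' = r * (m / x) * ((\<gamma> * x + 1) / (\<gamma> * m + 1)) * ((1 + k1)\<^sup>2 / (1 + k2)) \<and>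
     u' = u * (x / m) * ((\<gamma> * m + 1) / (\<gamma> * x + 1)) * ((1 + k2) / (1 + k1)) \<and>
     p' = p * ((\<gamma> * m + 1) / (\<gamma> * x + 1)) * (1 + k2)"
proof -
  define a where "a = \<gamma> * m + 1"
  define b where "b = \<gamma> * x + 1"
  define c1 c2 c3 where "c1 = 1 + k1" and "c2 = 1 + k2" and "c3 = 1 + k3"
  define f where "f = 2 + (\<gamma> - 1) * m"
  define h where "h = 2 + (\<gamma> - 1) * x"
  have P: "a > 0" "b > 0" "c1 > 0" "c2 > 0" "c3 > 0" "f > 0" "h > 0"
    using g k pos by (auto simp: a_def b_def c1_def c2_def c3_def f_def h_def add_pos_pos)
  have ma: "r * u\<^sup>2 + p = p * a" using m by (simp add: a_def algebra_simps)
  have xb: "r' * u'\<^sup>2 + p' = p' * b" using x by (simp add: b_def algebra_simps)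
  have mom: "p * a * c2 = p' * b \<longleftrightarrow> p' = p * (a / b) * c2"
    using P by (auto simp: field_simps)
  have vel: "r * u * c1 = r' * u' \<longleftrightarrow> u' = u * (x / m) * (a / b) * (c2 / c1)"
    if p': "p' = p * (a / b) * c2"
  proof -
    \<comment> \<open>Multiplying by \<open>u * u'\<close> creates \<open>r * u\<^sup>2\<close> and
      \<open>r' * u'\<^sup>2\<close>, which the Mach relations express by pressures; this removes
      both densities.\<close>
    have "r * u * c1 = r' * u' \<longleftrightarrow> (r * u * c1) * (u * u') = (r' * u') * (u * u')"
      using pos by simp
    also have "\<dots> \<longleftrightarrow> (r * u\<^sup>2) * c1 * u' = (r' * u'\<^sup>2) * u"
      by (simp add: power2_eq_square ac_simps)
    also have "\<dots> \<longleftrightarrow> (\<gamma> * p) * (m * c1 * u') = (\<gamma> * p) * (u * x * (a / b) * c2)"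
      unfolding m x p' by (simp add: ac_simps)
    also have "\<dots> \<longleftrightarrow> m * c1 * u' = u * x * (a / b) * c2"
      using g pos by (simp only: mult_cancel_left) auto
    also have "\<dots> \<longleftrightarrow> u' = u * (x / m) * (a / b) * (c2 / c1)"
      using P pos by (auto simp: field_simps)
    finally show ?thesis .
  qed
  \<comment> \<open>One direction suffices: by \<open>vel\<close> the formula for \<open>u'\<close>
    already implies mass balance, because x ties \<open>r'\<close> to \<open>p'\<close> and
    \<open>u'\<close>.\<close>
  have den: "r' = r * (m / x) * (b / a) * (c1\<^sup>2 / c2)"
    if "r * u * c1 = r' * u'" and u': "u' = u * (x / m) * (a / b) * (c2 / c1)"
  proof -
    have "r' = r * u * c1 / u'" using that(1) pos by (simp add: field_simps)
    also have "\<dots> = r * (m / x) * (b / a) * (c1\<^sup>2 / c2)"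
      unfolding u' using P pos by (simp add: field_simps power2_eq_square)
    finally show ?thesis .
  qed
  have en: "p * f * u * c3 = p' * h * u' \<longleftrightarrow> x * h * a\<^sup>2 = c1 * c3 / c2\<^sup>2 * (m * f) * b\<^sup>2"
    if p': "p' = p * (a / b) * c2" and u': "u' = u * (x / m) * (a / b) * (c2 / c1)"
  proof -
    have "p * f * u * c3 = p' * h * u' \<longleftrightarrow>
       (p * u) * (f * c3) = (p * u) * ((a / b) * c2 * h * (x / m) * (a / b) * (c2 / c1))"
      unfolding p' u' by (simp add: ac_simps)
    also have "\<dots> \<longleftrightarrow> f * c3 = (a / b) * c2 * h * (x / m) * (a / b) * (c2 / c1)"
      using pos by (simp only: mult_cancel_left) auto
    also have "\<dots> \<longleftrightarrow> x * h * a\<^sup>2 = c1 * c3 / c2\<^sup>2 * (m * f) * b\<^sup>2"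
      using P pos by (auto simp: field_simps power2_eq_square)
    finally show ?thesis .
  qed
  show ?thesis
    unfolding ma xb a_def[symmetric] b_def[symmetric] c1_def[symmetric] c2_def[symmetric]
      c3_def[symmetric] f_def[symmetric] h_def[symmetric]
    using mom vel den en by blast
qed

section \<open>From real variables back to Euler states\<close>

text \<open>Eliminating the velocity from the kinetic energy leaves an enthalpy depending on
  pressure and Mach number; its constant factor later cancels from the energy balance.\<close>

lemma admissible_mach:
  assumes "\<gamma> > 1" "admissible \<gamma> U"
  shows "sound_speed \<gamma> U > 0"
    and "velocity U = mach \<gamma> U * sound_speed \<gamma> U"
    and "dens U * (velocity U)\<^sup>2 = \<gamma> * pressure \<gamma> U * (mach \<gamma> U)\<^sup>2"
    and "(energy U + pressure \<gamma> U) * velocity U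
       = \<gamma> / (2 * (\<gamma> - 1)) * (pressure \<gamma> U * (2 + (\<gamma> - 1) * (mach \<gamma> U)\<^sup>2) * velocity U)"
proof -
  have p: "dens U > 0" "pressure \<gamma> U > 0" using assms by (auto simp: admissible_def)
  show s: "sound_speed \<gamma> U > 0" using assms p by (simp add: sound_speed_def)
  then show v: "velocity U = mach \<gamma> U * sound_speed \<gamma> U" by (simp add: mach_def)
  have "(sound_speed \<gamma> U)\<^sup>2 = \<gamma> * pressure \<gamma> U / dens U"
    using assms p by (simp add: sound_speed_def)
  then show d: "dens U * (velocity U)\<^sup>2 = \<gamma> * pressure \<gamma> U * (mach \<gamma> U)\<^sup>2"
    using p by (simp add: v power_mult_distrib)
  have "energy U = pressure \<gamma> U / (\<gamma> - 1) + 1 / 2 * (dens U * (velocity U)\<^sup>2)"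
    using assms by (simp add: pressure_def)
  then have "energy U + pressure \<gamma> U = \<gamma> / (2 * (\<gamma> - 1)) * (pressure \<gamma> U * (2 + (\<gamma> - 1) * (mach \<gamma> U)\<^sup>2))"
    unfolding d using assms by (simp add: field_simps)
  then show "(energy U + pressure \<gamma> U) * velocity U
       = \<gamma> / (2 * (\<gamma> - 1)) * (pressure \<gamma> U * (2 + (\<gamma> - 1) * (mach \<gamma> U)\<^sup>2) * velocity U)"
    by simp
qed

text \<open>Only the first eigenvalue can change sign when both velocities are positive, and it is
  the sound speed times (Mach number - 1).\<close>

lemma monotonicity_criterion_iff:
  assumes "\<gamma> > 1" "admissible \<gamma> U" "admissible \<gamma> V" "velocity U > 0" "velocity V > 0"
  shows "monotonicity_criterion \<gamma> U V \<longleftrightarrow> (mach \<gamma> U - 1) * (mach \<gamma> V - 1) \<ge> 0"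
proof -
  note U = admissible_mach[OF assms(1,2)] and V = admissible_mach[OF assms(1,3)]
  have "lambda1 \<gamma> U * lambda1 \<gamma> V
     = (sound_speed \<gamma> U * sound_speed \<gamma> V) * ((mach \<gamma> U - 1) * (mach \<gamma> V - 1))"
    unfolding lambda1_def U(2) V(2) by (simp add: algebra_simps)
  moreover have "sound_speed \<gamma> U * sound_speed \<gamma> V > 0" using U(1) V(1) by simp
  ultimately have "lambda1 \<gamma> U * lambda1 \<gamma> V \<ge> 0 \<longleftrightarrow> (mach \<gamma> U - 1) * (mach \<gamma> V - 1) \<ge> 0"
    by (metis mult_le_cancel_left_pos mult_zero_right)
  moreover have "lambda2 \<gamma> U * lambda2 \<gamma> V \<ge> 0" "lambda3 \<gamma> U * lambda3 \<gamma> V \<ge> 0"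
    using assms U(1) V(1) by (simp_all add: lambda2_def lambda3_def)
  ultimately show ?thesis by (simp add: monotonicity_criterion_def)
qed

theorem proposition2p2:
  fixes \<gamma> k1 k2 k3 k Mm I :: real and Um :: euler_state
  assumes "\<gamma> > 1"
    and "k1 > -1" and "k2 > -1" and "k3 > -1"
    and "k = (1 + k1) * (1 + k3) / (1 + k2)\<^sup>2 - 1"
    and "dens Um > 0" and "pressure \<gamma> Um > 0" and "velocity Um > 0"
    and "Mm = mach \<gamma> Um"
    and "I = sqrt ((\<gamma> * Mm\<^sup>2 + 1)\<^sup>2
                   - (\<gamma> + 1) * Mm\<^sup>2 * ((\<gamma> - 1) * Mm\<^sup>2 + 2) * (1 + k))
             / (\<gamma> * Mm\<^sup>2 + 1)"
  shows "wave_set \<gamma> Um k1 k2 k3 =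
    {Up. admissible \<gamma> Up \<and>
       (let Mp = mach \<gamma> Up in
         (k > 0 \<and> (0 < Mm \<and> Mm \<le> M1_crit \<gamma> k \<and> Mp = sqrt ((1 - I) / (1 + \<gamma> * I))
                   \<or> M2_crit \<gamma> k \<le> ereal Mm \<and> Mp = sqrt ((1 + I) / (1 - \<gamma> * I)))
          \<or> k < 0 \<and> (0 < Mm \<and> Mm \<le> 1 \<and> Mp = sqrt ((1 - I) / (1 + \<gamma> * I))
                   \<or> 1 \<le> Mm \<and> Mm < M3_crit \<gamma> k \<and> Mp = sqrt ((1 + I) / (1 - \<gamma> * I)))
          \<or> k = 0 \<and> (0 < Mm \<and> Mm \<le> 1 \<and> Mp = sqrt ((1 - I) / (1 + \<gamma> * I))
                   \<or> 1 < Mm \<and> Mp = sqrt ((1 + I) / (1 - \<gamma> * I))))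
         \<and> dens Up = dens Um * (Mm / Mp)\<^sup>2 * ((\<gamma> * Mp\<^sup>2 + 1) / (\<gamma> * Mm\<^sup>2 + 1))
                       * ((1 + k1)\<^sup>2 / (1 + k2))
         \<and> velocity Up = velocity Um * (Mp / Mm)\<^sup>2 * ((\<gamma> * Mm\<^sup>2 + 1) / (\<gamma> * Mp\<^sup>2 + 1))
                       * ((1 + k2) / (1 + k1))
         \<and> pressure \<gamma> Up = pressure \<gamma> Um * ((\<gamma> * Mm\<^sup>2 + 1) / (\<gamma> * Mp\<^sup>2 + 1)) * (1 + k2))}"
proof -
  note g = assms(1)
  have adm: "admissible \<gamma> Um" using assms by (simp add: admissible_def)
  note Um = admissible_mach[OF g adm, folded assms(9)]
  have Mm: "Mm > 0" using Um(1) assms by (simp add: mach_def)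
  have k1: "k > -1" using assms by simp
  have "\<gamma> * Mm\<^sup>2 + 1 > 0" using g Mm by (simp add: add_pos_pos)
  then have I: "I = sqrt (mach_disc \<gamma> k (Mm\<^sup>2))"
    unfolding assms(10) mach_disc_def by (simp add: real_sqrt_divide)
  have kk: "(1 + k1) * (1 + k3) / (1 + k2)\<^sup>2 = 1 + k" using assms(5) by simp
  have wave: "stationary_wave \<gamma> k1 k2 k3 Um Up \<longleftrightarrow>
      admissible \<gamma> Up \<and> mach \<gamma> Up > 0 \<and>
      (((mach \<gamma> Up)\<^sup>2 - 1) / (\<gamma> * (mach \<gamma> Up)\<^sup>2 + 1))\<^sup>2 = mach_disc \<gamma> k (Mm\<^sup>2) \<and>
      dens Up = dens Um * (Mm / mach \<gamma> Up)\<^sup>2 * ((\<gamma> * (mach \<gamma> Up)\<^sup>2 + 1) / (\<gamma> * Mm\<^sup>2 + 1))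
                  * ((1 + k1)\<^sup>2 / (1 + k2)) \<and>
      velocity Up = velocity Um * (mach \<gamma> Up / Mm)\<^sup>2
                  * ((\<gamma> * Mm\<^sup>2 + 1) / (\<gamma> * (mach \<gamma> Up)\<^sup>2 + 1)) * ((1 + k2) / (1 + k1)) \<and>
      pressure \<gamma> Up = pressure \<gamma> Um * ((\<gamma> * Mm\<^sup>2 + 1) / (\<gamma> * (mach \<gamma> Up)\<^sup>2 + 1)) * (1 + k2)"
    (is "?W \<longleftrightarrow> ?A \<and> ?M \<and> ?S") for Up
  proof -
    have "?M" if ?W
    proof -
      have up: "admissible \<gamma> Up" "dens Um * velocity Um * (1 + k1) = dens Up * velocity Up"
        using that by (auto simp: stationary_wave_def)
      \<comment> \<open>Mass balance carries the positive flux of \<open>Um\<close> over to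
        \<open>Up\<close>, so its Mach number is positive.\<close>
      have "dens Up * velocity Up > 0" unfolding up(2)[symmetric] using assms by simp
      then have "velocity Up > 0" using up(1) by (simp add: admissible_def zero_less_mult_iff)
      then show ?M using admissible_mach(1)[OF g up(1)] by (simp add: mach_def)
    qed
    moreover have "?W \<longleftrightarrow> ?S" if A: ?A and M: ?M
    proof -
      note Up = admissible_mach[OF g A]
      have v: "velocity Up > 0" using Up(1,2) M by simp
      have p: "dens Up > 0" "pressure \<gamma> Up > 0" using A by (auto simp: admissible_def)
      have m2: "Mm\<^sup>2 > 0" "(mach \<gamma> Up)\<^sup>2 > 0" using Mm M by auto
      have c: "\<gamma> / (2 * (\<gamma> - 1)) \<noteq> 0" using g by simp
      have e: "(energy Um + pressure \<gamma> Um) * velocity Um * (1 + k3)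
          = (energy Up + pressure \<gamma> Up) * velocity Up \<longleftrightarrow>
         pressure \<gamma> Um * (2 + (\<gamma> - 1) * Mm\<^sup>2) * velocity Um * (1 + k3)
          = pressure \<gamma> Up * (2 + (\<gamma> - 1) * (mach \<gamma> Up)\<^sup>2) * velocity Up"
        unfolding Um(4) Up(4) using c by (simp only: mult.assoc mult_cancel_left) blast
      show ?thesis
        unfolding stationary_wave_def e mach_relation_iff[OF g m2] power_divide[of Mm] power_divide[of _ Mm]
        using jump_relation_iff[OF g assms(2-4,6,8,7) m2(1) p(1) v p(2) m2(2) Um(3) Up(3)]
          adm A assms(8) unfolding kk by blast
    qed
    ultimately show ?thesis by (auto simp: stationary_wave_def)
  qed
  have vpos: "velocity Up > 0" if "admissible \<gamma> Up" "mach \<gamma> Up > 0" for Up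
    using admissible_mach(1,2)[OF g that(1)] that by simp
  show ?thesis
    \<comment> \<open>Read from right to left, the case lemma folds the displayed list back into the
      relation for y plus the sign condition, which are the jump relation and the Monotonicity
      Criterion.\<close>
    unfolding wave_set_def Let_def I mach_relation_cases[OF g k1 Mm, symmetric] wave
    using monotonicity_criterion_iff[OF g adm _ assms(8) vpos, folded assms(9)]
    by (intro Collect_cong) blast
qed

end
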